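(* Let $\mathcal{C}=\langle X,T,A,q_0\rangle$ be a concurrent transition system, $Y\subseteq X$, and $\mathcal{C}'$ its transaction system with respect to $Y$, with state set $X'=X\times H$. Let $\mathbf{N}=\bigcap_{i\in P}N_i\subseteq X'$. Then $|\mathbf{N}|=|X|$, and every state $\langle q,h\rangle$ reachable from $q_0'$ via $\bigcup_{i\in P}\hookrightarrow_i$ satisfies that $q$ is reachable from $q_0$ in $\mathcal{C}$.
   Context: A concurrent transition system (CTS) for a finite set $P$ of processes is a tuple $\mathcal{C}=\langle X,T,A,q_0\rangle$ where $X$ is a set of states, $q_0\in X$, $A=\biguplus_{i\in P}A_i$ is a finite set of actions partitioned among the processes, and $T\subseteq X\times A\times X$; $T_i=T\cap(X\times A_i\times X)$. For $\alpha\in A$ let $\xrightarrow{\alpha}=\{(q,q')\mid (q,\alpha,q')\in T\}$; $\mathrm{en}(q)=\{\alpha\mid \exists q'\colon (q,\alpha,q')\in T\}$, $\mathrm{dis}(q)=A\setminus\mathrm{en}(q)$; $R\circ Q=\{(x,z)\mid\exists y\colon (x,y)\in R,(y,z)\in Q\}$; for a set $S$, $S\lhd R=R\cap(S\times X')$ and $R\rhd S=R\cap(X'\times S)$; $\overline{S}$ is the complement of $S$ in $X'$. $\alpha$ right-commutes with $\beta$ if $\xrightarrow{\alpha}\circ\xrightarrow{\beta}\subseteq\xrightarrow{\beta}\circ\xrightarrow{\alpha}$, left-commutes if $\supseteq$ holds. For each $q,\alpha$ a family $\mathrm{nes}_q(\alpha)$ of necessary enabling sets is given: each $E\in\mathrm{nes}_q(\alpha)$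 meets $\{\alpha_1,\dots,\alpha_n\}$ for every execution $q\xrightarrow{\alpha_1}\cdots\xrightarrow{\alpha_n}q''$ with $\alpha\in\mathrm{dis}(q)$, $\alpha\in\mathrm{en}(q'')$. For $\star\in\{\leftarrow,\rightarrow\}$, $B\subseteq A$ is semi-$\star$-stubborn in $q$ ($\mathrm{sst}^\star_q(B)$) if every $\alpha\in B\cap\mathrm{dis}(q)$ has some $E\in\mathrm{nes}_q(\alpha)$ with $E\subseteq B$, and for every $\alpha\in B\cap\mathrm{en}(q)$ and $\beta\in A$ such that $\alpha$ does not left-commute (for $\star=\leftarrow$), resp. right-commute (for $\star=\rightarrow$), with $\beta$, we have $\beta\in B$. $\mathrm{lm}_i(q)$ holds iff some $B$ has $\mathrm{sst}^\leftarrow_q(B)$ and $B\cap\mathrm{en}(q)=A_i\cap\mathrm{en}(q)$. $\mathrm{rm}_i(q,\alpha,q')$ holds iff some $B$ has $\mathrm{sst}^\rightarrow_q(B)$, $\alpha\in B$, $B\cap\mathrm{en}(q')\subseteq A_i$, $B\cap\mathrm{en}(q)=\{\alpha\}$. Let $A^Y_\oplus=\{\alpha\mid\exists (q,\alpha,q')\in T,\ q\notin Y,\ q'\in Y\}$ and $A^Y_\ominus=\{\alpha\mid\exists(q,\alpha,q')\in T,\ q\in Y,\ q'\notin Y\}$. Transaction system: $H=\{N,R,L\}^P$, $X'=X\times H$, $q_0'=\langle q_0,N^P\rangle$. For $i\in P$, $T'_i$ consists of the triples $(\langle q,h\rangle,\alpha,\langle q',h'\rangle)$ with $(q,\alpha,q')\in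 T_i$, $h'_j=h_j$ for all $j\neq i$, and: $h'_i=R$ if and only if $h_i\neq L$, $\mathrm{rm}_i(q,\alpha,q')$ and $\alpha\notin A^Y_\ominus$; otherwise $h'_i=L$ if $\mathrm{lm}_i(q')$ and $\mathrm{en}(q')\cap A_i\cap A^Y_\oplus=\emptyset$, where in that case the definition also allows $N$ as an alternative; otherwise $h'_i=N$ (the choice between $L$ and $N$ in the overlapping case is left open; fix any resolution). Let $N_i=\{\langle q,h\rangle\in X'\mid h_i=N\}$ and $\to'_i=\{(x,x')\mid \exists\alpha\colon (x,\alpha,x')\in T'_i\}$. Define $\rightsquigarrow_i=\big(\bigcap_{j\neq i}N_j\big)\lhd\to'_i$ and $\hookrightarrow_i=N_i\lhd\big(\rightsquigarrow_i\rhd\overline{N_i}\big)^*\circ\rightsquigarrow_i\rhd N_i$; the reduced transaction system has transition relation $\bigcup_i\hookrightarrow_i$ and initial state $q_0'$. *)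

theory Defs
  imports Main "HOL-Library.FuncSet" "HOL-Library.Disjoint_Sets" "HOL-Library.Equipollence"
begin

record ('x, 'p, 'a) cts =
  states :: "'x set"
  procs :: "'p set"
  acts :: "'p \<Rightarrow> 'a set"
  transitions :: "('x \<times> 'a \<times> 'x) set"
  init :: "'x"

definition actions :: "('x, 'p, 'a) cts \<Rightarrow> 'a set" where
  "actions C = (\<Union>i\<in>procs C. acts C i)"

definition concurrent_transition_system :: "('x, 'p, 'a) cts \<Rightarrow> bool" where
  "concurrent_transition_system C \<longleftrightarrow>
     finite (procs C) \<and> finite (actions C) \<and> disjoint_family_on (acts C) (procs C) \<and>
     transitions C \<subseteq> states C \<times> actions C \<times> states C \<and> init C \<in> states C"

definition proc_transitions :: "('x, 'p, 'a) cts \<Rightarrow> 'p \<Rightarrow> ('x \<times> 'a \<times> 'x) set" where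
  "proc_transitions C i = transitions C \<inter> (states C \<times> acts C i \<times> states C)"

definition act_rel :: "('x, 'p, 'a) cts \<Rightarrow> 'a \<Rightarrow> ('x \<times> 'x) set" where
  "act_rel C \<alpha> = {(q, q'). (q, \<alpha>, q') \<in> transitions C}"

definition step_rel :: "('x, 'p, 'a) cts \<Rightarrow> ('x \<times> 'x) set" where
  "step_rel C = (\<Union>\<alpha>\<in>actions C. act_rel C \<alpha>)"

definition en :: "('x, 'p, 'a) cts \<Rightarrow> 'x \<Rightarrow> 'a set" where
  "en C q = {\<alpha>. \<exists>q'. (q, \<alpha>, q') \<in> transitions C}"

definition dis :: "('x, 'p, 'a) cts \<Rightarrow> 'x \<Rightarrow> 'a set" where
  "dis C q = actions C - en C q"

fun execution :: "('x, 'p, 'a) cts \<Rightarrow> 'x \<Rightarrow> 'a list \<Rightarrow> 'x \<Rightarrow> bool" where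
  "execution C q [] q'' \<longleftrightarrow> q = q''"
| "execution C q (\<alpha> # \<alpha>s) q'' \<longleftrightarrow> (\<exists>q'. (q, \<alpha>, q') \<in> transitions C \<and> execution C q' \<alpha>s q'')"

definition right_commutes :: "('x, 'p, 'a) cts \<Rightarrow> 'a \<Rightarrow> 'a \<Rightarrow> bool" where
  "right_commutes C \<alpha> \<beta> \<longleftrightarrow> act_rel C \<alpha> O act_rel C \<beta> \<subseteq> act_rel C \<beta> O act_rel C \<alpha>"

definition left_commutes :: "('x, 'p, 'a) cts \<Rightarrow> 'a \<Rightarrow> 'a \<Rightarrow> bool" where
  "left_commutes C \<alpha> \<beta> \<longleftrightarrow> act_rel C \<alpha> O act_rel C \<beta> \<supseteq> act_rel C \<beta> O act_rel C \<alpha>"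

definition necessary_enabling_sets ::
  "('x, 'p, 'a) cts \<Rightarrow> ('x \<Rightarrow> 'a \<Rightarrow> 'a set set) \<Rightarrow> bool" where
  "necessary_enabling_sets C nes \<longleftrightarrow>
     (\<forall>q\<in>states C. \<forall>\<alpha>\<in>actions C. \<forall>E\<in>nes q \<alpha>. \<forall>\<alpha>s q''.
        execution C q \<alpha>s q'' \<and> \<alpha> \<in> dis C q \<and> \<alpha> \<in> en C q'' \<longrightarrow> E \<inter> set \<alpha>s \<noteq> {})"

text \<open>The common part of the two notions of semi-stubborn set; the predicate \<open>com\<close> is
  instantiated with left- and right-commutation below.\<close>

definition semi_stubborn ::
  "('a \<Rightarrow> 'a \<Rightarrow> bool) \<Rightarrow> ('x, 'p, 'a) cts \<Rightarrow> ('x \<Rightarrow> 'a \<Rightarrow> 'a set set) \<Rightarrow> 'x \<Rightarrow> 'a set \<Rightarrow> bool" where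
  "semi_stubborn com C nes q B \<longleftrightarrow>
     B \<subseteq> actions C \<and>
     (\<forall>\<alpha>\<in>B \<inter> dis C q. \<exists>E\<in>nes q \<alpha>. E \<subseteq> B) \<and>
     (\<forall>\<alpha>\<in>B \<inter> en C q. \<forall>\<beta>\<in>actions C. \<not> com \<alpha> \<beta> \<longrightarrow> \<beta> \<in> B)"

definition sst_left ::
  "('x, 'p, 'a) cts \<Rightarrow> ('x \<Rightarrow> 'a \<Rightarrow> 'a set set) \<Rightarrow> 'x \<Rightarrow> 'a set \<Rightarrow> bool" where
  "sst_left C = semi_stubborn (left_commutes C) C"

definition sst_right ::
  "('x, 'p, 'a) cts \<Rightarrow> ('x \<Rightarrow> 'a \<Rightarrow> 'a set set) \<Rightarrow> 'x \<Rightarrow> 'a set \<Rightarrow> bool" where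
  "sst_right C = semi_stubborn (right_commutes C) C"

definition lm :: "('x, 'p, 'a) cts \<Rightarrow> ('x \<Rightarrow> 'a \<Rightarrow> 'a set set) \<Rightarrow> 'p \<Rightarrow> 'x \<Rightarrow> bool" where
  "lm C nes i q \<longleftrightarrow> (\<exists>B. sst_left C nes q B \<and> B \<inter> en C q = acts C i \<inter> en C q)"

definition rm ::
  "('x, 'p, 'a) cts \<Rightarrow> ('x \<Rightarrow> 'a \<Rightarrow> 'a set set) \<Rightarrow> 'p \<Rightarrow> 'x \<Rightarrow> 'a \<Rightarrow> 'x \<Rightarrow> bool" where
  "rm C nes i q \<alpha> q' \<longleftrightarrow>
     (\<exists>B. sst_right C nes q B \<and> \<alpha> \<in> B \<and> B \<inter> en C q' \<subseteq> acts C i \<and> B \<inter> en C q = {\<alpha>})"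

definition entering :: "('x, 'p, 'a) cts \<Rightarrow> 'x set \<Rightarrow> 'a set" where
  "entering C Y = {\<alpha>. \<exists>q q'. (q, \<alpha>, q') \<in> transitions C \<and> q \<notin> Y \<and> q' \<in> Y}"

definition leaving :: "('x, 'p, 'a) cts \<Rightarrow> 'x set \<Rightarrow> 'a set" where
  "leaving C Y = {\<alpha>. \<exists>q q'. (q, \<alpha>, q') \<in> transitions C \<and> q \<in> Y \<and> q' \<notin> Y}"

datatype phase = NPh | RPh | LPh

type_synonym ('x, 'p) tstate = "'x \<times> ('p \<Rightarrow> phase)"

text \<open>Phase vectors are extensional functions on the set of processes, so that they are in
  bijection with the tuples indexed by the processes.\<close>

definition phase_vectors :: "('x, 'p, 'a) cts \<Rightarrow> ('p \<Rightarrow> phase) set" where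
  "phase_vectors C = procs C \<rightarrow>\<^sub>E {NPh, RPh, LPh}"

definition tstates :: "('x, 'p, 'a) cts \<Rightarrow> ('x, 'p) tstate set" where
  "tstates C = states C \<times> phase_vectors C"

text \<open>A resolution gives, for each process, source state (with phases), action and target state,
  the phases that are permitted where both the left phase and the neutral phase are possible.
  Singletons are the deterministic resolutions; \<open>{LPh, NPh}\<close> keeps both alternatives.\<close>

type_synonym ('x, 'p, 'a) resolution = "'p \<Rightarrow> ('x, 'p) tstate \<Rightarrow> 'a \<Rightarrow> 'x \<Rightarrow> phase set"

definition valid_resolution :: "('x, 'p, 'a) resolution \<Rightarrow> bool" where
  "valid_resolution res \<longleftrightarrow> (\<forall>i x \<alpha> q'. res i x \<alpha> q' \<noteq> {} \<and> res i x \<alpha> q' \<subseteq> {LPh, NPh})"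

definition next_phases ::
  "('x, 'p, 'a) cts \<Rightarrow> ('x \<Rightarrow> 'a \<Rightarrow> 'a set set) \<Rightarrow> 'x set \<Rightarrow> ('x, 'p, 'a) resolution \<Rightarrow>
   'p \<Rightarrow> ('x, 'p) tstate \<Rightarrow> 'a \<Rightarrow> 'x \<Rightarrow> phase set" where
  "next_phases C nes Y res i x \<alpha> q' =
     (if snd x i \<noteq> LPh \<and> rm C nes i (fst x) \<alpha> q' \<and> \<alpha> \<notin> leaving C Y then {RPh}
      else if lm C nes i q' \<and> en C q' \<inter> acts C i \<inter> entering C Y = {} then res i x \<alpha> q'
      else {NPh})"

definition ttransitions ::
  "('x, 'p, 'a) cts \<Rightarrow> ('x \<Rightarrow> 'a \<Rightarrow> 'a set set) \<Rightarrow> 'x set \<Rightarrow> ('x, 'p, 'a) resolution \<Rightarrow>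
   'p \<Rightarrow> (('x, 'p) tstate \<times> 'a \<times> ('x, 'p) tstate) set" where
  "ttransitions C nes Y res i =
     {((q, h), \<alpha>, (q', h')).
        (q, h) \<in> tstates C \<and> (q', h') \<in> tstates C \<and>
        (q, \<alpha>, q') \<in> proc_transitions C i \<and>
        (\<forall>j\<in>procs C - {i}. h' j = h j) \<and>
        h' i \<in> next_phases C nes Y res i (q, h) \<alpha> q'}"

definition transaction_system ::
  "('x, 'p, 'a) cts \<Rightarrow> ('x \<Rightarrow> 'a \<Rightarrow> 'a set set) \<Rightarrow> 'x set \<Rightarrow> ('x, 'p, 'a) resolution \<Rightarrow>
   (('x, 'p) tstate, 'p, 'a) cts" where
  "transaction_system C nes Y res =
     \<lparr>states = tstates C, procs = procs C, acts = acts C,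
      transitions = (\<Union>i\<in>procs C. ttransitions C nes Y res i),
      init = (init C, \<lambda>i\<in>procs C. NPh)\<rparr>"

definition neutral :: "('x, 'p, 'a) cts \<Rightarrow> 'p \<Rightarrow> ('x, 'p) tstate set" where
  "neutral C i = {(q, h) \<in> tstates C. h i = NPh}"

text \<open>Intersections of families of subsets of the state space of the transaction system are
  taken within that state space: the empty intersection is the whole state space.\<close>

definition all_neutral :: "('x, 'p, 'a) cts \<Rightarrow> ('x, 'p) tstate set" where
  "all_neutral C = tstates C \<inter> (\<Inter>i\<in>procs C. neutral C i)"

definition restrict_dom :: "'s set \<Rightarrow> ('s \<times> 's) set \<Rightarrow> ('s \<times> 's) set" where
  "restrict_dom S R = {(x, y) \<in> R. x \<in> S}"

definition restrict_ran :: "('s \<times> 's) set \<Rightarrow> 's set \<Rightarrow> ('s \<times> 's) set" where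
  "restrict_ran R S = {(x, y) \<in> R. y \<in> S}"

definition tstep ::
  "('x, 'p, 'a) cts \<Rightarrow> ('x \<Rightarrow> 'a \<Rightarrow> 'a set set) \<Rightarrow> 'x set \<Rightarrow> ('x, 'p, 'a) resolution \<Rightarrow>
   'p \<Rightarrow> ('x, 'p) tstate rel" where
  "tstep C nes Y res i = {(x, x'). \<exists>\<alpha>. (x, \<alpha>, x') \<in> ttransitions C nes Y res i}"

definition exclusive_step ::
  "('x, 'p, 'a) cts \<Rightarrow> ('x \<Rightarrow> 'a \<Rightarrow> 'a set set) \<Rightarrow> 'x set \<Rightarrow> ('x, 'p, 'a) resolution \<Rightarrow>
   'p \<Rightarrow> ('x, 'p) tstate rel" where
  "exclusive_step C nes Y res i =
     restrict_dom (tstates C \<inter> (\<Inter>j\<in>procs C - {i}. neutral C j)) (tstep C nes Y res i)"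

definition block_step ::
  "('x, 'p, 'a) cts \<Rightarrow> ('x \<Rightarrow> 'a \<Rightarrow> 'a set set) \<Rightarrow> 'x set \<Rightarrow> ('x, 'p, 'a) resolution \<Rightarrow>
   'p \<Rightarrow> ('x, 'p) tstate rel" where
  "block_step C nes Y res i =
     restrict_dom (neutral C i)
       ((restrict_ran (exclusive_step C nes Y res i) (tstates C - neutral C i))\<^sup>* O
        restrict_ran (exclusive_step C nes Y res i) (neutral C i))"

definition reduced_step ::
  "('x, 'p, 'a) cts \<Rightarrow> ('x \<Rightarrow> 'a \<Rightarrow> 'a set set) \<Rightarrow> 'x set \<Rightarrow> ('x, 'p, 'a) resolution \<Rightarrow>
   ('x, 'p) tstate rel" where
  "reduced_step C nes Y res = (\<Union>i\<in>procs C. block_step C nes Y res i)"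

end

theory Submission
  imports Defs
begin

text \<open>In a state of \<open>all_neutral C\<close> every process has phase \<open>NPh\<close>,
  and an extensional phase vector is determined by its values on \<open>procs C\<close>. So only the
  first component is free, and the set is a copy of \<open>states C\<close>
  (\<open>all_neutral_eq\<close>). For reachability, a reduced step is a finite chain of transaction
  steps of one process (\<open>block_step_subset\<close>), and forgetting the phases turns each of
  these into a step of \<open>C\<close> (\<open>tstep_step_rel\<close>); hence paths project to
  paths.\<close>

lemma all_neutral_eq: "all_neutral C = states C \<times> {\<lambda>i\<in>procs C. NPh}"
proof (intro equalityI subsetI)
  fix x assume x: "x \<in> all_neutral C"
  obtain q h where [simp]: "x = (q, h)" by (cases x)
  have q: "q \<in> states C" and h: "h \<in> procs C \<rightarrow>\<^sub>E {NPh, RPh, LPh}"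
    and N: "\<And>i. i \<in> procs C \<Longrightarrow> h i = NPh"
    using x by (auto simp: all_neutral_def tstates_def phase_vectors_def neutral_def)
  \<comment> \<open>Outside \<open>procs C\<close> both functions are \<open>undefined\<close>, by
    extensionality of \<open>h\<close>.\<close>
  have "h = (\<lambda>i\<in>procs C. NPh)"
    using N PiE_arb[OF h] by (auto simp: fun_eq_iff)
  with q show "x \<in> states C \<times> {\<lambda>i\<in>procs C. NPh}" by simp
next
  fix x assume "x \<in> states C \<times> {\<lambda>i\<in>procs C. NPh}"
  then show "x \<in> all_neutral C"
    unfolding all_neutral_def tstates_def phase_vectors_def neutral_def by auto
qed

lemma tstep_step_rel:
  assumes "i \<in> procs C" and "(x, y) \<in> tstep C nes Y res i"
  shows "(fst x, fst y) \<in> step_rel C"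
  using assms
  unfolding tstep_def ttransitions_def proc_transitions_def step_rel_def actions_def act_rel_def
  by fastforce

text \<open>Domain and range restrictions only remove pairs, so all neutrality conditions may be
  dropped; a chain of steps of process \<open>i\<close> remains.\<close>

lemma block_step_subset: "block_step C nes Y res i \<subseteq> (tstep C nes Y res i)\<^sup>*"
proof -
  have sub: "restrict_ran (exclusive_step C nes Y res i) S \<subseteq> tstep C nes Y res i" for S
    by (auto simp: restrict_ran_def exclusive_step_def restrict_dom_def)
  have "block_step C nes Y res i \<subseteq> (tstep C nes Y res i)\<^sup>* O tstep C nes Y res i"
  proof (rule subset_trans)
    show "block_step C nes Y res i \<subseteq>
        (restrict_ran (exclusive_step C nes Y res i) (tstates C - neutral C i))\<^sup>* O
        restrict_ran (exclusive_step C nes Y res i) (neutral C i)"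
      unfolding block_step_def restrict_dom_def by blast
  qed (intro relcomp_mono rtrancl_mono sub)
  also have "\<dots> \<subseteq> (tstep C nes Y res i)\<^sup>*"
    by (blast intro: rtrancl_into_rtrancl)
  finally show ?thesis .
qed

text \<open>The right-hand side is already a closure, so single reduced steps suffice. Passing to
  the union over all processes lets blocks of different processes be concatenated.\<close>

lemma reduced_step_rtrancl_subset:
  "(reduced_step C nes Y res)\<^sup>* \<subseteq> (\<Union>i\<in>procs C. tstep C nes Y res i)\<^sup>*"
proof (rule rtrancl_subset_rtrancl)
  have "(tstep C nes Y res i)\<^sup>* \<subseteq> (\<Union>i\<in>procs C. tstep C nes Y res i)\<^sup>*" if "i \<in> procs C" for i
    using that by (intro rtrancl_mono) blast
  then show "reduced_step C nes Y res \<subseteq> (\<Union>i\<in>procs C. tstep C nes Y res i)\<^sup>*"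
    unfolding reduced_step_def by (intro UN_least subset_trans[OF block_step_subset])
qed

lemma reduced_reachable_step_rel:
  assumes "(x, y) \<in> (reduced_step C nes Y res)\<^sup>*"
  shows "(fst x, fst y) \<in> (step_rel C)\<^sup>*"
proof -
  have "(x, y) \<in> (\<Union>i\<in>procs C. tstep C nes Y res i)\<^sup>*"
    using assms reduced_step_rtrancl_subset by blast
  then show ?thesis
  proof (induction rule: rtrancl_induct)
    case (step y z)
    from step.hyps(2) have "(fst y, fst z) \<in> step_rel C"
      by (blast intro: tstep_step_rel)
    with step.IH show ?case
      by (rule rtrancl_into_rtrancl)
  qed simp
qed

theorem theorem5:
  fixes C :: "('x, 'p, 'a) cts"
    and nes :: "'x \<Rightarrow> 'a \<Rightarrow> 'a set set"
    and Y :: "'x set"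
    and res :: "('x, 'p, 'a) resolution"
  assumes "concurrent_transition_system C"
    and "necessary_enabling_sets C nes"
    and "Y \<subseteq> states C"
    and "valid_resolution res"
  shows "all_neutral C \<approx> states C \<and>
    (\<forall>q h. (init (transaction_system C nes Y res), (q, h)) \<in> (reduced_step C nes Y res)\<^sup>* \<longrightarrow>
      (init C, q) \<in> (step_rel C)\<^sup>*)"
proof (intro conjI allI impI)
  show "all_neutral C \<approx> states C"
    unfolding all_neutral_eq
    \<comment> \<open>Swapping the factors puts the singleton on the left, where it can be
      cancelled.\<close>
    using times_commute_eqpoll times_singleton_eqpoll by (rule eqpoll_trans)
next
  fix q h
  assume "(init (transaction_system C nes Y res), (q, h)) \<in> (reduced_step C nes Y res)\<^sup>*"
  from reduced_reachable_step_rel[OF this] show "(init C, q) \<in> (step_rel C)\<^sup>*"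
    by (simp add: transaction_system_def)
qed

end
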